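(* Let $(A,m_A)$ be an equicharacteristic noetherian local domain which is not a field, and let $\nu$ be a valuation of the quotient field of $A$ which dominates $A$. Let $s_0=\min\{\nu(f)\mid f\in m_A\}$ and $n=\dim_{A/m_A} m_A/m_A^2$. Then $$ |S^A(\nu)\cap [0,(d+1)s_0)|<\binom{n+d}{n} $$ for all $d\in\mathbb{N}$.
   Context: $|T|$ denotes the cardinality of a set $T$. A noetherian local domain is equicharacteristic if it has the same characteristic as its residue field. A valuation $\nu$ of the quotient field of $A$, with valuation ring $V$ and maximal ideal $m_V$, dominates $A$ if $A\subset V$ and $m_V\cap A=m_A$. The convention $\nu(0)=\infty$ is used, so $s_0$ is the minimum of the values of nonzero elements of $m_A$. Let $\Gamma$ be the value group of $\nu$ (a totally ordered abelian group, written additively); it has finite rank because $\nu$ dominates the noetherian local domain $A$. Let $\Psi$ be the convex subgroup of $\Gamma$ of real rank 1 (that is, the smallest nonzero convex subgroup, which is order isomorphic to a subgroup of $\mathbb{R}$). Define $$ S^A(\nu)=\nu(m_A-\{0\})\cap\Psi . $$ The interval notation means $[0,b)=\{c\in\Psi\mid 0\le c<b\}$, with the comparison made in $\Gamma$. *)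

theory Defs
  imports
    "HOL-Algebra.Algebra"
    "Jordan_Normal_Form.Missing_VectorSpace"
begin

section \<open>Local rings\<close>

locale local_ring = cring R + maximalideal m R for R (structure) and m +
  assumes unique_maximalideal: "maximalideal m' R \<Longrightarrow> m' = m"

text \<open>The least positive \<open>n\<close> with \<open>n \<cdot> 1 = 0\<close>, and \<open>0\<close> if there is none.\<close>

definition ring_char :: "('a, 'b) ring_scheme \<Rightarrow> nat"
  where "ring_char R =
    (if \<exists>n>0. add_pow R (n::nat) \<one>\<^bsub>R\<^esub> = \<zero>\<^bsub>R\<^esub>
     then (LEAST n. n > 0 \<and> add_pow R n \<one>\<^bsub>R\<^esub> = \<zero>\<^bsub>R\<^esub>) else 0)"

definition equicharacteristic :: "('a, 'b) ring_scheme \<Rightarrow> 'a set \<Rightarrow> bool"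
  where "equicharacteristic R m \<longleftrightarrow> ring_char R = ring_char (R Quot m)"

text \<open>
  The module \<open>m / m\<^sup>2\<close> over \<open>R / m\<close>.  Its elements are the cosets of \<open>m\<^sup>2\<close> in \<open>m\<close>, and
  \<open>(m + a) \<odot> (m\<^sup>2 + x) = m\<^sup>2 + a x\<close>; as \<open>m x \<subseteq> m\<^sup>2\<close> for \<open>x \<in> m\<close>, the product of the two
  cosets modulo \<open>m\<^sup>2\<close> is exactly this coset (see \<open>cotangent_smult\<close> below).  The fields
  \<open>mult\<close> and \<open>one\<close>, which every module record contains, play no role.
\<close>

definition cotangent_space :: "('a, 'b) ring_scheme \<Rightarrow> 'a set \<Rightarrow> ('a set, 'a set) module"
  where "cotangent_space R m =
    \<lparr>carrier = (\<lambda>x. (m \<cdot>\<^bsub>R\<^esub> m) +>\<^bsub>R\<^esub> x) ` m,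
     monoid.mult = rcoset_mult R (m \<cdot>\<^bsub>R\<^esub> m),
     monoid.one = (m \<cdot>\<^bsub>R\<^esub> m) +>\<^bsub>R\<^esub> \<one>\<^bsub>R\<^esub>,
     ring.zero = m \<cdot>\<^bsub>R\<^esub> m,
     ring.add = set_add R,
     smult = rcoset_mult R (m \<cdot>\<^bsub>R\<^esub> m)\<rparr>"

definition embedding_dim :: "('a, 'b) ring_scheme \<Rightarrow> 'a set \<Rightarrow> nat"
  where "embedding_dim R m = vectorspace.dim (R Quot m) (cotangent_space R m)"


section \<open>Quotient fields and valuations\<close>

text \<open>A domain is represented as a subring \<open>A\<close> of its quotient field \<open>K\<close>.\<close>

locale quotient_field = field K + subring A K for K (structure) and A +
  assumes fraction: "x \<in> carrier K \<Longrightarrow> \<exists>a\<in>A. \<exists>b\<in>A - {\<zero>}. x = a \<otimes> inv b"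

text \<open>
  The convention \<open>\<nu>(0) = \<infinity>\<close> is implemented by leaving the value of \<open>\<nu>\<close> at \<open>\<zero>\<close> unspecified and
  treating \<open>\<zero>\<close> separately.  The value group need not be the whole type \<open>'g\<close>.
\<close>

locale valuation = field K for K (structure) +
  fixes \<nu> :: "'a \<Rightarrow> 'g::linordered_ab_group_add"
  assumes val_mult:
      "\<lbrakk>x \<in> carrier K - {\<zero>}; y \<in> carrier K - {\<zero>}\<rbrakk> \<Longrightarrow> \<nu> (x \<otimes> y) = \<nu> x + \<nu> y"
    and val_add:
      "\<lbrakk>x \<in> carrier K - {\<zero>}; y \<in> carrier K - {\<zero>}; x \<oplus> y \<noteq> \<zero>\<rbrakk>
        \<Longrightarrow> min (\<nu> x) (\<nu> y) \<le> \<nu> (x \<oplus> y)"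

definition value_group :: "('a, 'b) ring_scheme \<Rightarrow> ('a \<Rightarrow> 'g) \<Rightarrow> 'g set"
  where "value_group K \<nu> = \<nu> ` (carrier K - {\<zero>\<^bsub>K\<^esub>})"

definition valuation_ring ::
    "('a, 'b) ring_scheme \<Rightarrow> ('a \<Rightarrow> 'g::linordered_ab_group_add) \<Rightarrow> 'a set"
  where "valuation_ring K \<nu> = {x \<in> carrier K. x = \<zero>\<^bsub>K\<^esub> \<or> 0 \<le> \<nu> x}"

definition valuation_ideal ::
    "('a, 'b) ring_scheme \<Rightarrow> ('a \<Rightarrow> 'g::linordered_ab_group_add) \<Rightarrow> 'a set"
  where "valuation_ideal K \<nu> = {x \<in> carrier K. x = \<zero>\<^bsub>K\<^esub> \<or> 0 < \<nu> x}"

definition dominates ::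
    "('a, 'b) ring_scheme \<Rightarrow> ('a \<Rightarrow> 'g::linordered_ab_group_add) \<Rightarrow> 'a set \<Rightarrow> 'a set \<Rightarrow> bool"
  where "dominates K \<nu> A m \<longleftrightarrow> A \<subseteq> valuation_ring K \<nu> \<and> valuation_ideal K \<nu> \<inter> A = m"

definition convex_subgroup :: "'g::linordered_ab_group_add set \<Rightarrow> 'g set \<Rightarrow> bool"
  where "convex_subgroup \<Gamma> H \<longleftrightarrow>
    H \<subseteq> \<Gamma> \<and> 0 \<in> H \<and> (\<forall>x\<in>H. \<forall>y\<in>H. x + y \<in> H) \<and> (\<forall>x\<in>H. - x \<in> H) \<and>
    (\<forall>x\<in>H. \<forall>y\<in>\<Gamma>. 0 \<le> y \<and> y \<le> x \<longrightarrow> y \<in> H)"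

text \<open>
  The smallest nonzero convex subgroup of \<open>\<Gamma>\<close>, as the intersection of all nonzero convex
  subgroups.  The lemmas \<open>rank1_subgroup_eq\<close> and \<open>rank1_subgroup_least\<close> show that this is the
  smallest nonzero convex subgroup whenever there is one, in particular if \<open>\<Gamma>\<close> is nonzero and of
  finite rank.
\<close>

definition rank1_subgroup :: "'g::linordered_ab_group_add set \<Rightarrow> 'g set"
  where "rank1_subgroup \<Gamma> = {x \<in> \<Gamma>. \<forall>H. convex_subgroup \<Gamma> H \<and> H \<noteq> {0} \<longrightarrow> x \<in> H}"

definition ideal_values :: "('a, 'b) ring_scheme \<Rightarrow> ('a \<Rightarrow> 'g) \<Rightarrow> 'a set \<Rightarrow> 'g set"
  where "ideal_values K \<nu> m = \<nu> ` (m - {\<zero>\<^bsub>K\<^esub>})"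

definition min_value ::
    "('a, 'b) ring_scheme \<Rightarrow> ('a \<Rightarrow> 'g::linordered_ab_group_add) \<Rightarrow> 'a set \<Rightarrow> 'g"
  where "min_value K \<nu> m = (LEAST g. g \<in> ideal_values K \<nu> m)"

definition rank1_values ::
    "('a, 'b) ring_scheme \<Rightarrow> ('a \<Rightarrow> 'g::linordered_ab_group_add) \<Rightarrow> 'a set \<Rightarrow> 'g set"
  where "rank1_values K \<nu> m = ideal_values K \<nu> m \<inter> rank1_subgroup (value_group K \<nu>)"

text \<open>The bound \<open>b\<close> need not lie in the rank one subgroup.\<close>

definition rank1_interval :: "'g::linordered_ab_group_add set \<Rightarrow> 'g \<Rightarrow> 'g set"
  where "rank1_interval \<Gamma> b = {c \<in> rank1_subgroup \<Gamma>. 0 \<le> c \<and> c < b}"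


section \<open>Consistency of the definitions\<close>

lemma rank1_subgroup_eq:
  assumes "convex_subgroup \<Gamma> H" "H \<noteq> {0}"
    and "\<And>H'. convex_subgroup \<Gamma> H' \<Longrightarrow> H' \<noteq> {0} \<Longrightarrow> H \<subseteq> H'"
  shows "rank1_subgroup \<Gamma> = H"
proof
  show "rank1_subgroup \<Gamma> \<subseteq> H" using assms(1,2) by (auto simp: rank1_subgroup_def)
  have "H \<subseteq> \<Gamma>" using assms(1) by (simp add: convex_subgroup_def)
  then show "H \<subseteq> rank1_subgroup \<Gamma>" using assms(3) unfolding rank1_subgroup_def by blast
qed

lemma convex_subgroup_linear:
  assumes H: "convex_subgroup \<Gamma> H" and H': "convex_subgroup \<Gamma> H'"
  shows "H \<subseteq> H' \<or> H' \<subseteq> H"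
proof (rule ccontr)
  assume "\<not> ?thesis"
  then obtain x y where x: "x \<in> H" "x \<notin> H'" and y: "y \<in> H'" "y \<notin> H" by blast
  define u v where "u = max x (- x)" and "v = max y (- y)"
  have mem: "max z (- z) \<in> G \<longleftrightarrow> z \<in> G" if "convex_subgroup \<Gamma> G" for z G
    using that unfolding convex_subgroup_def by (metis max_def minus_minus)
  have nonneg: "0 \<le> max z (- z)" for z :: 'a
    by (metis le_max_iff_disj linear neg_0_le_iff_le)
  have uv: "u \<in> H" "u \<notin> H'" "v \<in> H'" "v \<notin> H"
    using x y mem[OF H] mem[OF H'] by (simp_all add: u_def v_def)
  have pos: "0 \<le> u" "0 \<le> v" using nonneg by (simp_all add: u_def v_def)
  have "u \<in> \<Gamma>" "v \<in> \<Gamma>" using uv H H' by (auto simp: convex_subgroup_def)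
  then show False
    using uv pos H H' unfolding convex_subgroup_def by (metis linear)
qed

lemma rank1_subgroup_least:
  assumes \<Gamma>: "convex_subgroup \<Gamma> \<Gamma>" "\<Gamma> \<noteq> {0}" and fin: "finite {H. convex_subgroup \<Gamma> H}"
  shows "convex_subgroup \<Gamma> (rank1_subgroup \<Gamma>)" "rank1_subgroup \<Gamma> \<noteq> {0}"
    "\<And>H. convex_subgroup \<Gamma> H \<Longrightarrow> H \<noteq> {0} \<Longrightarrow> rank1_subgroup \<Gamma> \<subseteq> H"
proof -
  let ?C = "{H. convex_subgroup \<Gamma> H \<and> H \<noteq> {0}}"
  have C: "finite ?C" "\<Gamma> \<in> ?C"
    using fin \<Gamma> by (auto elim: rev_finite_subset)
  then obtain M where M: "M \<in> ?C" "\<And>H. H \<in> ?C \<Longrightarrow> H \<subseteq> M \<Longrightarrow> H = M"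
    using finite_has_minimal2[of ?C \<Gamma>] by (metis (no_types, lifting))
  have least: "M \<subseteq> H" if "H \<in> ?C" for H
    using M convex_subgroup_linear[of \<Gamma> M H] that by blast
  have eq: "rank1_subgroup \<Gamma> = M"
    using M(1) least by (intro rank1_subgroup_eq) auto
  show "convex_subgroup \<Gamma> (rank1_subgroup \<Gamma>)" "rank1_subgroup \<Gamma> \<noteq> {0}"
    "\<And>H. convex_subgroup \<Gamma> H \<Longrightarrow> H \<noteq> {0} \<Longrightarrow> rank1_subgroup \<Gamma> \<subseteq> H"
    using M(1) least unfolding eq by auto
qed

context local_ring
begin

lemma ideal_m2: "ideal (m \<cdot> m) R"
  using ideal_prod_is_ideal[OF is_ideal is_ideal] .

lemma m2_subset: "m \<cdot> m \<subseteq> m"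
  using ideal_prod_inter[OF is_ideal is_ideal] by blast

lemma residue_field: "field (R Quot m)"
  using quotient_is_field[OF cring_axioms] .

lemma cotangent_smult:
  assumes a: "a \<in> carrier R" and x: "x \<in> m"
  shows "rcoset_mult R (m \<cdot> m) (m +> a) ((m \<cdot> m) +> x) = (m \<cdot> m) +> (a \<otimes> x)"
proof -
  interpret I: ideal "m \<cdot> m" R by (rule ideal_m2)
  have xc: "x \<in> carrier R" using x Icarr by blast
  have *: "(m \<cdot> m) +> (u \<otimes> v) = (m \<cdot> m) +> (a \<otimes> x)"
    if uv: "u \<in> m +> a" "v \<in> (m \<cdot> m) +> x" for u v
  proof -
    from uv obtain h k where h: "h \<in> m" "u = h \<oplus> a" and k: "k \<in> m \<cdot> m" "v = k \<oplus> x"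
      by (auto simp: a_r_coset_def r_coset_def)
    have c: "h \<in> carrier R" "k \<in> carrier R" using h k Icarr I.Icarr by blast+
    have "h \<otimes> k \<oplus> h \<otimes> x \<oplus> a \<otimes> k \<in> m \<cdot> m"
      using I.I_l_closed[OF k(1) c(1)] I.I_l_closed[OF k(1) a] ideal_prod.prod[of h m x m R] h x
      by auto
    moreover have "u \<otimes> v = (h \<otimes> k \<oplus> h \<otimes> x \<oplus> a \<otimes> k) \<oplus> a \<otimes> x"
      using c a xc h k by algebra
    ultimately have "u \<otimes> v \<in> (m \<cdot> m) +> (a \<otimes> x)"
      by (auto simp: a_r_coset_def r_coset_def)
    then show ?thesis by (intro I.a_repr_independence'[symmetric] m_closed a xc)
  qed
  have "m +> a \<noteq> {}" "(m \<cdot> m) +> x \<noteq> {}"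
    using a xc a_rcos_self I.a_rcos_self by blast+
  moreover have "rcoset_mult R (m \<cdot> m) (m +> a) ((m \<cdot> m) +> x) =
      (\<Union>u\<in>m +> a. \<Union>v\<in>(m \<cdot> m) +> x. (m \<cdot> m) +> (a \<otimes> x))"
    unfolding rcoset_mult_def by (intro SUP_cong refl *)
  ultimately show ?thesis by simp
qed

lemma cotangent_vectorspace: "vectorspace (R Quot m) (cotangent_space R m)"
proof -
  interpret I: ideal "m \<cdot> m" R by (rule ideal_m2)
  interpret F: field "R Quot m" by (rule residue_field)
  let ?J = "m \<cdot> m" and ?V = "cotangent_space R m"
  have mc: "x \<in> carrier R" if "x \<in> m" for x using that Icarr by blast
  have car: "carrier ?V = (\<lambda>x. ?J +> x) ` m" and add: "ring.add ?V = set_add R"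
    and zero: "ring.zero ?V = ?J" and sm: "smult ?V = rcoset_mult R ?J"
    by (simp_all add: cotangent_space_def)
  have fcar: "carrier (R Quot m) = (\<lambda>x. m +> x) ` carrier R"
    by (auto simp: FactRing_def A_RCOSETS_def' a_r_coset_def)
  have sum: "(?J +> x) <+>\<^bsub>R\<^esub> (?J +> y) = ?J +> (x \<oplus> y)" if "x \<in> carrier R" "y \<in> carrier R" for x y
    using I.a_rcos_sum that by blast
  have fsum: "(m +> x) <+>\<^bsub>R\<^esub> (m +> y) = m +> (x \<oplus> y)" if "x \<in> carrier R" "y \<in> carrier R" for x y
    using a_rcos_sum that by blast
  have zJ: "?J = ?J +> \<zero>" using a_rcos_zero[OF ideal_m2 I.zero_closed] by simp
  have mem: "?J +> x \<in> carrier ?V" if "x \<in> m" for x using that by (simp add: car)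
  have sumV: "(?J +> x) \<oplus>\<^bsub>?V\<^esub> (?J +> y) = ?J +> (x \<oplus> y)" if "x \<in> m" "y \<in> m" for x y
    using sum that mc by (simp add: add)
  have elim: thesis if "u \<in> carrier ?V" "\<And>x. x \<in> m \<Longrightarrow> u = ?J +> x \<Longrightarrow> thesis" for u thesis
    using that by (auto simp: car)
  have grp: "abelian_group ?V"
  proof (rule abelian_groupI)
    show "\<zero>\<^bsub>?V\<^esub> \<in> carrier ?V" using zJ mem[OF zero_closed] by (simp add: zero)
  next
    fix u v assume "u \<in> carrier ?V" "v \<in> carrier ?V"
    then obtain x y where x: "x \<in> m" "u = ?J +> x" and y: "y \<in> m" "v = ?J +> y" by (meson elim)
    show "u \<oplus>\<^bsub>?V\<^esub> v \<in> carrier ?V" using x y mem[OF a_closed] by (simp add: sumV)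
    show "u \<oplus>\<^bsub>?V\<^esub> v = v \<oplus>\<^bsub>?V\<^esub> u" using x y mc by (simp add: sumV a_comm)
    fix w assume "w \<in> carrier ?V"
    then obtain z where z: "z \<in> m" "w = ?J +> z" by (meson elim)
    show "u \<oplus>\<^bsub>?V\<^esub> v \<oplus>\<^bsub>?V\<^esub> w = u \<oplus>\<^bsub>?V\<^esub> (v \<oplus>\<^bsub>?V\<^esub> w)"
      using x y z mc by (simp add: sumV a_assoc)
  next
    fix u assume "u \<in> carrier ?V"
    then obtain x where x: "x \<in> m" "u = ?J +> x" by (meson elim)
    show "\<zero>\<^bsub>?V\<^esub> \<oplus>\<^bsub>?V\<^esub> u = u"
      unfolding zero x(2) by (subst zJ, subst sumV) (use x mc in simp_all)
    have i: "\<ominus> x \<in> m" using x a_inv_closed by simp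
    have "(?J +> (\<ominus> x)) \<oplus>\<^bsub>?V\<^esub> u = \<zero>\<^bsub>?V\<^esub>"
      unfolding zero x(2) sumV[OF i x(1)] by (subst (2) zJ) (use x mc in \<open>simp add: l_neg\<close>)
    then show "\<exists>v\<in>carrier ?V. v \<oplus>\<^bsub>?V\<^esub> u = \<zero>\<^bsub>?V\<^esub>" using mem[OF i] by blast
  qed
  have smV: "(m +> a) \<odot>\<^bsub>?V\<^esub> (?J +> x) = ?J +> (a \<otimes> x)" if "a \<in> carrier R" "x \<in> m" for a x
    using cotangent_smult that by (simp add: sm)
  have F: "\<one>\<^bsub>R Quot m\<^esub> = m +> \<one>"
    "(m +> a) \<oplus>\<^bsub>R Quot m\<^esub> (m +> b) = m +> (a \<oplus> b)"
    "(m +> a) \<otimes>\<^bsub>R Quot m\<^esub> (m +> b) = m +> (a \<otimes> b)"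
    if "a \<in> carrier R" "b \<in> carrier R" for a b
    using that fsum rcoset_mult_add by (simp_all add: FactRing_def)
  have "module (R Quot m) ?V"
  proof (intro module.intro F.is_cring grp module_axioms.intro)
    fix \<alpha> \<beta> u v assume "\<alpha> \<in> carrier (R Quot m)" "\<beta> \<in> carrier (R Quot m)"
      and uv: "u \<in> carrier ?V" "v \<in> carrier ?V"
    then obtain a b where ab: "a \<in> carrier R" "\<alpha> = m +> a" "b \<in> carrier R" "\<beta> = m +> b"
      by (auto simp: fcar)
    obtain x y where xy: "x \<in> m" "u = ?J +> x" "y \<in> m" "v = ?J +> y" using uv by (meson elim)
    note facts = ab xy mc I_l_closed smV sumV F
    show "(\<alpha> \<oplus>\<^bsub>R Quot m\<^esub> \<beta>) \<odot>\<^bsub>?V\<^esub> u = \<alpha> \<odot>\<^bsub>?V\<^esub> u \<oplus>\<^bsub>?V\<^esub> \<beta> \<odot>\<^bsub>?V\<^esub> u"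
      by (simp add: facts l_distr)
    show "\<alpha> \<odot>\<^bsub>?V\<^esub> (u \<oplus>\<^bsub>?V\<^esub> v) = \<alpha> \<odot>\<^bsub>?V\<^esub> u \<oplus>\<^bsub>?V\<^esub> \<alpha> \<odot>\<^bsub>?V\<^esub> v"
      by (simp add: facts r_distr)
    show "(\<alpha> \<otimes>\<^bsub>R Quot m\<^esub> \<beta>) \<odot>\<^bsub>?V\<^esub> u = \<alpha> \<odot>\<^bsub>?V\<^esub> (\<beta> \<odot>\<^bsub>?V\<^esub> u)"
      by (simp add: facts m_assoc)
  next
    fix \<alpha> u assume "\<alpha> \<in> carrier (R Quot m)" and u: "u \<in> carrier ?V"
    then obtain a where a: "a \<in> carrier R" "\<alpha> = m +> a" by (auto simp: fcar)
    obtain x where x: "x \<in> m" "u = ?J +> x" using u by (meson elim)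
    show "\<alpha> \<odot>\<^bsub>?V\<^esub> u \<in> carrier ?V" using a x by (simp add: smV mem I_l_closed)
  next
    fix u assume "u \<in> carrier ?V"
    then obtain x where x: "x \<in> m" "u = ?J +> x" by (meson elim)
    show "\<one>\<^bsub>R Quot m\<^esub> \<odot>\<^bsub>?V\<^esub> u = u" using x mc by (simp add: F(1)[of \<one> \<one>] smV)
  qed
  then show ?thesis by (intro vectorspace.intro residue_field)
qed

end

end

theory Submission
  imports Defs
begin

text \<open>
  The bound comes from the filtration \<open>R \<supseteq> m \<supseteq> m\<^sup>2 \<supseteq> \<dots> \<supseteq> m\<^sup>d\<^sup>+\<^sup>1\<close> of the local ring.  An element of
  \<open>m\<^sup>d\<^sup>+\<^sup>1\<close> has value at least \<open>(d + 1) s\<^sub>0\<close>, so every smaller value is lost somewhere on the way from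
  \<open>R\<close> down to \<open>m\<^sup>d\<^sup>+\<^sup>1\<close>, and it suffices to count how many values each step can lose.

  The key observation (\<open>unique_new_value\<close>) is that adding one element \<open>g\<close> with \<open>m g \<subseteq> J\<close> to an ideal
  \<open>J\<close> creates at most one new value.  Indeed \<open>(J + R g) / J\<close> is a vector space of dimension at most one
  over \<open>R / m\<close>, so two elements outside \<open>J\<close> are proportional modulo \<open>J\<close> by a factor outside \<open>m\<close>,
  which has value \<open>0\<close>; if their values differed, the difference of the one with larger value and the
  appropriate multiple of the other would lie in \<open>J\<close> and have the smaller of the two values.

  If \<open>n\<close> elements of \<open>m\<close> span \<open>m / m\<^sup>2\<close>, then their monomials of degree \<open>i\<close> generate \<open>m\<^sup>i\<close> modulo
  \<open>m\<^sup>i\<^sup>+\<^sup>1\<close> (\<open>ideal_power_generators\<close>).  Hence the step from \<open>m\<^sup>i\<close> to \<open>m\<^sup>i\<^sup>+\<^sup>1\<close> loses at most as many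
  values as there are such monomials, and there are \<open>(n + d) choose n\<close> monomials of degree at most \<open>d\<close>.
  The value \<open>0\<close> of the unit element is among the values counted, but it is not the value of an
  element of \<open>m\<close>; this makes the inequality strict.
\<close>

(* Both the sum of subsets of a ring and the disjoint sum of sets are written <+>. *)
no_notation Sum_Type.Plus (infixr \<open><+>\<close> 65)

section \<open>Monomials of a fixed degree\<close>

context monoid
begin

text \<open>
  A list rather than a set, because the count only needs an upper bound and the length satisfies
  Pascal's recursion even when different monomials have the same value in the monoid.
\<close>

fun monomials :: "'a list \<Rightarrow> nat \<Rightarrow> 'a list" where
  "monomials xs 0 = [\<one>]"
| "monomials [] (Suc i) = []"
| "monomials (x # xs) (Suc i) =
     map (\<lambda>g. x \<otimes> g) (monomials (x # xs) i) @ monomials xs (Suc i)"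

lemma length_monomials_Cons:
  "length (monomials (x # xs) (Suc i)) =
    length (monomials (x # xs) i) + length (monomials xs (Suc i))"
  by simp

lemma monomials_closed:
  "set xs \<subseteq> carrier G \<Longrightarrow> set (monomials xs i) \<subseteq> carrier G"
  by (induction xs i rule: monomials.induct) auto

text \<open>
  The monomials of degree at most \<open>d + 1\<close> in \<open>x, xs\<close> are those divisible by \<open>x\<close>, which correspond to monomials of degree at most \<open>d\<close>, and those in \<open>xs\<close> alone:
  this is Pascal's rule.
\<close>

lemma sum_length_monomials:
  "(\<Sum>i\<le>d. length (monomials xs i)) = (length xs + d) choose length xs"
proof (induction xs arbitrary: d)
  case Nil
  have "length (monomials [] i) = (if i = 0 then 1 else 0)" for i
    by (cases i) auto
  then show ?case by simp
next
  case (Cons x xs)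
  show ?case
  proof (induction d)
    case 0
    show ?case by simp
  next
    case (Suc d)
    have "(\<Sum>i\<le>Suc d. length (monomials (x # xs) i)) =
        1 + (\<Sum>i\<le>d. length (monomials (x # xs) (Suc i)))"
      by (subst sum.atMost_Suc_shift) simp
    also have "\<dots> = (\<Sum>i\<le>d. length (monomials (x # xs) i)) +
        (1 + (\<Sum>i\<le>d. length (monomials xs (Suc i))))"
      by (simp only: length_monomials_Cons sum.distrib)
    also have "1 + (\<Sum>i\<le>d. length (monomials xs (Suc i))) =
        (\<Sum>i\<le>Suc d. length (monomials xs i))"
      by (subst sum.atMost_Suc_shift) simp
    finally show ?case
      by (simp only: Cons.IH Suc.IH) (simp add: binomial_Suc_Suc add.commute)
  qed
qed

end

text \<open>
  The recursion allows multiplication by the first variable only; a later variable has to be moved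
  past the leading factors \<open>x\<close>, which is where commutativity enters.
\<close>

lemma (in comm_monoid) mult_in_monomials:
  assumes "set xs \<subseteq> carrier G" "y \<in> set xs" "g \<in> set (monomials xs i)"
  shows "y \<otimes> g \<in> set (monomials xs (Suc i))"
  using assms
proof (induction xs arbitrary: y g i)
  case (Cons x xs)
  note outer = Cons.IH and car = Cons.prems(1)
  show ?case using Cons.prems(2,3)
  proof (induction i arbitrary: g)
    case 0
    then show ?case using outer[of y g 0] car by auto
  next
    case (Suc i)
    show ?case
    proof (cases "y = x \<or> g \<in> set (monomials xs (Suc i))")
      case True
      then show ?thesis using Suc.prems outer[of y g "Suc i"] car by auto
    next
      case False
      then obtain h where h: "h \<in> set (monomials (x # xs) i)" "g = x \<otimes> h"
        using Suc.prems by auto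
      have "h \<in> carrier G" using h(1) monomials_closed[OF car] by blast
      then have "y \<otimes> g = x \<otimes> (y \<otimes> h)"
        using h(2) Suc.prems(1) car m_lcomm by auto
      then have "y \<otimes> g \<in> (\<lambda>g. x \<otimes> g) ` set (monomials (x # xs) (Suc i))"
        using Suc.IH[OF Suc.prems(1) h(1)] by blast
      then show ?thesis by (simp only: monomials.simps(3)[of x xs "Suc i"] set_append set_map Un_iff simp_thms)
    qed
  qed
qed simp

section \<open>Generators of the powers of an ideal\<close>

context cring
begin

text \<open>
  To show that all products of two ideals lie in \<open>Q\<close>, it is enough, by this lemma, to check
  generators of the ideals one factor at a time.
\<close>

lemma colon_ideal:
  assumes "ideal Q R" "c \<in> carrier R"
  shows "ideal {x \<in> carrier R. x \<otimes> c \<in> Q} R"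
proof -
  interpret Q: ideal Q R by fact
  show ?thesis
  proof (rule idealI[OF ring_axioms])
    show "subgroup {x \<in> carrier R. x \<otimes> c \<in> Q} (add_monoid R)"
      using assms(2)
      by (auto simp: subgroup_def l_distr l_minus simp flip: a_inv_def)
  next
    fix a x assume "a \<in> {x \<in> carrier R. x \<otimes> c \<in> Q}" "x \<in> carrier R"
    then have *: "a \<in> carrier R" "x \<in> carrier R" "x \<otimes> (a \<otimes> c) \<in> Q"
      using Q.I_l_closed by auto
    then show "x \<otimes> a \<in> {x \<in> carrier R. x \<otimes> c \<in> Q}"
      using assms(2) by (simp add: m_assoc)
    with * show "a \<otimes> x \<in> {x \<in> carrier R. x \<otimes> c \<in> Q}" by (simp add: m_comm)
  qed
qed

lemma genideal_insert_subset:
  assumes "g \<in> carrier R" "S \<subseteq> carrier R"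
  shows "Idl (insert g S) \<subseteq> PIdl g <+> Idl S"
proof (rule genideal_minimal)
  interpret P: ideal "PIdl g" R by (rule cgenideal_ideal[OF assms(1)])
  interpret I: ideal "Idl S" R by (rule genideal_ideal[OF assms(2)])
  show "ideal (PIdl g <+> Idl S) R" by (rule add_ideals[OF P.ideal_axioms I.ideal_axioms])
  have "g = g \<oplus> \<zero>" using assms(1) by simp
  moreover have "s = \<zero> \<oplus> s" if "s \<in> S" for s using that assms(2) by auto
  ultimately show "insert g S \<subseteq> PIdl g <+> Idl S"
    unfolding set_add_def'
    using cgenideal_self[OF assms(1)] genideal_self[OF assms(2)] P.zero_closed I.zero_closed
    by blast
qed

fun ideal_power :: "'a set \<Rightarrow> nat \<Rightarrow> 'a set" where
  "ideal_power I 0 = carrier R"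
| "ideal_power I (Suc i) = I \<cdot> ideal_power I i"

lemma ideal_power_ideal: "ideal I R \<Longrightarrow> ideal (ideal_power I i) R"
  by (induction i) (simp_all add: oneideal ideal_prod_is_ideal)

lemma ideal_prod_minimal:
  assumes "ideal Q R" "\<And>x y. x \<in> I \<Longrightarrow> y \<in> J \<Longrightarrow> x \<otimes> y \<in> Q"
  shows "I \<cdot> J \<subseteq> Q"
proof
  interpret Q: ideal Q R by fact
  fix s assume "s \<in> I \<cdot> J"
  then show "s \<in> Q" by induction (use assms(2) in auto)
qed

lemma monomials_in_ideal_power:
  assumes "ideal I R" "set xs \<subseteq> I"
  shows "set (monomials xs i) \<subseteq> ideal_power I i"
  using assms(2)
proof (induction xs i rule: monomials.induct)
  case (3 x xs i)
  then show ?case by (auto intro: ideal_prod.prod)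
qed auto

text \<open>
  The elements \<open>xs\<close> generate \<open>I\<close> only modulo \<open>I\<^sup>2\<close>.  The error terms cause no harm, since an
  element of \<open>I\<^sup>2\<close> times one of \<open>I\<^sup>i\<close>, like an element of \<open>I\<close> times one of \<open>I\<^sup>i\<^sup>+\<^sup>1\<close>, lies in
  \<open>I\<^sup>i\<^sup>+\<^sup>2\<close>.  Working modulo the next power in this way takes the place of Nakayama's lemma.
\<close>

lemma ideal_power_generators:
  assumes I: "ideal I R" and xs: "set xs \<subseteq> I" and gen: "I \<subseteq> Idl (set xs \<union> I \<cdot> I)"
  shows "ideal_power I i \<subseteq> Idl (set (monomials xs i) \<union> ideal_power I (Suc i))"
proof (induction i)
  case 0
  have "ideal_power I (Suc 0) \<subseteq> carrier R"
    using ideal.Icarr[OF ideal_power_ideal[OF I]] by blast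
  then have "Idl {\<one>} \<subseteq> Idl (set (monomials xs 0) \<union> ideal_power I (Suc 0))"
    by (intro genideal_minimal genideal_ideal)
      (use genideal_self[of "set (monomials xs 0) \<union> ideal_power I (Suc 0)"] in auto)
  then show ?case by (simp add: genideal_one)
next
  case (Suc i)
  let ?P = "ideal_power I" and ?M = "\<lambda>i. set (monomials xs i)"
  define Q where "Q = Idl (?M (Suc i) \<union> ?P (Suc (Suc i)))"
  have Ic: "x \<in> carrier R" if "x \<in> I" for x using that ideal.Icarr[OF I] by blast
  have Pc: "x \<in> carrier R" if "x \<in> ?P k" for x k
    using that ideal.Icarr[OF ideal_power_ideal[OF I]] by blast
  have xc: "set xs \<subseteq> carrier R" using xs Ic by blast
  have Mc: "?M k \<subseteq> carrier R" for k using monomials_closed[OF xc] .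
  have gc: "?M (Suc i) \<union> ?P (Suc (Suc i)) \<subseteq> carrier R"
    using Mc Pc by blast
  have Q: "ideal Q R" unfolding Q_def by (rule genideal_ideal[OF gc])
  have MQ: "?M (Suc i) \<subseteq> Q" and PQ: "?P (Suc (Suc i)) \<subseteq> Q"
    using genideal_self[OF gc] by (simp_all add: Q_def)
  \<comment> \<open>First the second factor is restricted to a monomial and the first one ranges over \<open>I\<close>.\<close>
  have mon: "x \<otimes> g \<in> Q" if x: "x \<in> I" and g: "g \<in> ?M i" for x g
  proof -
    have g': "g \<in> carrier R" "g \<in> ?P i"
      using g Mc monomials_in_ideal_power[OF I xs] by blast+
    have "I \<cdot> I \<subseteq> {x \<in> carrier R. x \<otimes> g \<in> Q}"
    proof (rule ideal_prod_minimal[OF colon_ideal[OF Q g'(1)]])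
      fix y z assume yz: "y \<in> I" "z \<in> I"
      then have "y \<otimes> (z \<otimes> g) \<in> ?P (Suc (Suc i))"
        using g'(2) by (auto intro: ideal_prod.prod)
      then show "y \<otimes> z \<in> {x \<in> carrier R. x \<otimes> g \<in> Q}"
        using PQ yz Ic g'(1) by (auto simp: m_assoc)
    qed
    moreover have "set xs \<subseteq> {x \<in> carrier R. x \<otimes> g \<in> Q}"
      using mult_in_monomials[OF xc _ g] MQ xc by auto
    ultimately have "Idl (set xs \<union> I \<cdot> I) \<subseteq> {x \<in> carrier R. x \<otimes> g \<in> Q}"
      by (intro genideal_minimal colon_ideal Q g') auto
    then show ?thesis using gen x by blast
  qed
  \<comment> \<open>Now the first factor is fixed and the second one ranges over the whole power of \<open>I\<close>.\<close>
  have "I \<cdot> ?P i \<subseteq> Q"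
  proof (rule ideal_prod_minimal[OF Q])
    fix x f assume x: "x \<in> I" and f: "f \<in> ?P i"
    have "?M i \<union> ?P (Suc i) \<subseteq> {y \<in> carrier R. y \<otimes> x \<in> Q}"
    proof
      fix y assume y: "y \<in> ?M i \<union> ?P (Suc i)"
      then have yc: "y \<in> carrier R" using Mc Pc by blast
      have "x \<otimes> y \<in> Q"
        using y mon[OF x] PQ x by (auto intro: ideal_prod.prod)
      then show "y \<in> {y \<in> carrier R. y \<otimes> x \<in> Q}"
        using yc Ic[OF x] by (simp add: m_comm)
    qed
    then have "Idl (?M i \<union> ?P (Suc i)) \<subseteq> {y \<in> carrier R. y \<otimes> x \<in> Q}"
      by (intro genideal_minimal colon_ideal Q Ic x)
    then have "f \<otimes> x \<in> Q" using Suc.IH f by blast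
    then show "x \<otimes> f \<in> Q" using Ic[OF x] Pc[OF f] by (simp add: m_comm)
  qed
  then show ?case by (simp add: Q_def)
qed

end

section \<open>Counting the values of a valuation\<close>

lemma antichain_card_le_1:
  fixes N :: "'g::linorder set"
  assumes "\<And>a b. a \<in> N \<Longrightarrow> b \<in> N \<Longrightarrow> \<not> a < b"
  shows "finite N \<and> card N \<le> 1"
proof -
  have "a = b" if "a \<in> N" "b \<in> N" for a b
    using assms[OF that] assms[OF that(2,1)] by simp
  then have "N = {} \<or> (\<exists>a. N = {a})" by blast
  then show ?thesis by auto
qed

text \<open>
  The restriction to a domain \<open>R\<close> of a valuation of its quotient field that is nonnegative on \<open>R\<close>
  and has centre \<open>m\<close>, that is, \<open>m\<close> consists of the elements of positive value.
\<close>

locale centred_valuation = domain R + maximalideal m R for R (structure) and m +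
  fixes v :: "'a \<Rightarrow> 'g::linordered_ab_group_add"
  assumes v_mult:
      "\<lbrakk>x \<in> carrier R - {\<zero>}; y \<in> carrier R - {\<zero>}\<rbrakk> \<Longrightarrow> v (x \<otimes> y) = v x + v y"
    and v_add:
      "\<lbrakk>x \<in> carrier R - {\<zero>}; y \<in> carrier R - {\<zero>}; x \<oplus> y \<noteq> \<zero>\<rbrakk>
        \<Longrightarrow> min (v x) (v y) \<le> v (x \<oplus> y)"
    and v_nonneg: "x \<in> carrier R - {\<zero>} \<Longrightarrow> 0 \<le> v x"
    and v_pos_iff: "x \<in> carrier R - {\<zero>} \<Longrightarrow> 0 < v x \<longleftrightarrow> x \<in> m"
begin

lemma v_one: "v \<one> = 0"
  using v_mult[of \<one> \<one>] by simp

lemma v_minus: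
  assumes "x \<in> carrier R - {\<zero>}"
  shows "v (\<ominus> x) = v x"
proof -
  have m1: "\<ominus> \<one> \<in> carrier R - {\<zero>}"
    using r_neg[of \<one>] by auto
  have "v (\<ominus> \<one>) + v (\<ominus> \<one>) = 0"
    using v_mult[OF m1 m1] v_one by (simp add: l_minus)
  then have "v (\<ominus> \<one>) = 0" using v_nonneg[OF m1] by (simp add: add_nonneg_eq_0_iff)
  then show ?thesis using v_mult[OF m1 assms] assms by (simp add: l_minus)
qed

text \<open>
  The usual strengthening of the triangle inequality: if the sum had larger value than \<open>x\<close>, then
  \<open>x = (x + y) - y\<close> would contradict it.
\<close>

lemma v_add_eq_left:
  assumes x: "x \<in> carrier R - {\<zero>}" and y: "y \<in> carrier R - {\<zero>}" and less: "v x < v y"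
  shows "x \<oplus> y \<noteq> \<zero>" "v (x \<oplus> y) = v x"
proof -
  have c: "x \<in> carrier R" "y \<in> carrier R" using x y by auto
  have my: "\<ominus> y \<in> carrier R - {\<zero>}" using y by auto
  show nz: "x \<oplus> y \<noteq> \<zero>"
  proof
    assume "x \<oplus> y = \<zero>"
    then have "x = \<ominus> y" using c by (metis minus_equality)
    then show False using less v_minus[OF y] by simp
  qed
  have "x \<oplus> y \<oplus> \<ominus> y = x" using c by algebra
  then have "min (v (x \<oplus> y)) (v y) \<le> v x"
    using v_add[of "x \<oplus> y" "\<ominus> y"] nz x my c v_minus[OF y] by simp
  then show "v (x \<oplus> y) = v x"
    using v_add[OF x y nz] less by (auto simp: min_def split: if_splits)
qed

lemma value_ge_ideal:
  "ideal {x \<in> carrier R. x = \<zero> \<or> s \<le> v x} R" (is "ideal ?S R")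
proof (rule idealI[OF ring_axioms])
  have "x \<oplus> y \<in> ?S" if "x \<in> ?S" "y \<in> ?S" for x y
  proof (cases "x = \<zero> \<or> y = \<zero> \<or> x \<oplus> y = \<zero>")
    case True
    then show ?thesis using that by auto
  next
    case False
    then have "s \<le> min (v x) (v y)" "min (v x) (v y) \<le> v (x \<oplus> y)"
      using that v_add[of x y] by auto
    then have "s \<le> v (x \<oplus> y)" by (rule order.trans)
    then show ?thesis using that by simp
  qed
  moreover have "\<ominus> x \<in> ?S" if "x \<in> ?S" for x
    using that v_minus[of x] by (cases "x = \<zero>") auto
  ultimately show "subgroup ?S (add_monoid R)"
    by (auto simp: subgroup_def simp flip: a_inv_def)
next
  fix a x assume a: "a \<in> ?S" and x: "x \<in> carrier R"
  have "s \<le> v x + v a" if "a \<noteq> \<zero>" "x \<noteq> \<zero>"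
    using that a x v_nonneg[of x] by (simp add: add_increasing)
  then show "x \<otimes> a \<in> ?S" using a x v_mult[of x a] by (cases "a = \<zero> \<or> x = \<zero>") auto
  then show "a \<otimes> x \<in> ?S" using a x by (simp add: m_comm)
qed

lemma inverse_mod_maximal:
  assumes "u \<in> carrier R - m"
  obtains b where "b \<in> carrier R - m" "\<one> \<ominus> b \<otimes> u \<in> m"
proof -
  have u: "u \<in> carrier R" "u \<notin> m" using assms by auto
  interpret P: ideal "PIdl u" R by (rule cgenideal_ideal[OF u(1)])
  have sum: "ideal (PIdl u <+> m) R" by (rule add_ideals[OF P.ideal_axioms is_ideal])
  have mem: "x \<oplus> y \<in> PIdl u <+> m" if "x \<in> PIdl u" "y \<in> m" for x y
    using that unfolding set_add_def' by blast
  have "m \<subseteq> PIdl u <+> m"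
  proof
    fix x assume x: "x \<in> m"
    show "x \<in> PIdl u <+> m" using mem[OF P.zero_closed x] Icarr[OF x] by simp
  qed
  moreover have "u \<in> PIdl u <+> m"
    using mem[OF cgenideal_self[OF u(1)] zero_closed] u(1) by simp
  moreover have "PIdl u <+> m \<subseteq> carrier R" using ideal.Icarr[OF sum] by blast
  ultimately have "PIdl u <+> m = carrier R" using I_maximal[OF sum] u by blast
  then have "\<one> \<in> PIdl u <+> m" by simp
  then obtain b h where b: "b \<in> carrier R" "h \<in> m" "\<one> = b \<otimes> u \<oplus> h"
    unfolding set_add_def' cgenideal_def by blast
  have "h \<in> carrier R" using b(2) Icarr by blast
  then have "(b \<otimes> u \<oplus> h) \<ominus> b \<otimes> u = h" using b(1) u(1) by algebra
  then have "\<one> \<ominus> b \<otimes> u = h" by (simp only: b(3)[symmetric])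
  then have bu: "\<one> \<ominus> b \<otimes> u \<in> m" using b by simp
  moreover have "b \<notin> m"
  proof
    assume "b \<in> m"
    then have "b \<otimes> u \<oplus> h \<in> m" using b(2) u(1) I_r_closed by simp
    then have "\<one> \<in> m" by (simp only: b(3)[symmetric])
    then show False using I_notcarr one_imp_carrier by simp
  qed
  ultimately show thesis using that[of b] b(1) by blast
qed

lemma v_eq_0:
  assumes "x \<in> carrier R - m"
  shows "x \<noteq> \<zero> \<and> v x = 0"
proof -
  have x: "x \<in> carrier R - {\<zero>}" using assms by auto
  then have "\<not> 0 < v x" "0 \<le> v x" using v_pos_iff v_nonneg assms by blast+
  then have "v x = 0" unfolding not_less by (rule order.antisym)
  then show ?thesis using x by blast
qed

text \<open>
  Write elements with the new values \<open>a < b\<close> as \<open>f = u g + j\<close> and \<open>f' = u' g + j'\<close>.  Neither \<open>u\<close> nor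
  \<open>u'\<close> lies in \<open>m\<close>, as otherwise the value would be one of \<open>J\<close>.  With an inverse \<open>c\<close> of \<open>u\<close>
  modulo \<open>m\<close>, the element \<open>f' - u' c f\<close> lies in \<open>J\<close>, because \<open>(1 - c u) g\<close> does.  As \<open>u' c\<close> has value
  \<open>0\<close>, the value of this element is \<open>a\<close>, so \<open>a\<close> was not new.
\<close>

lemma unique_new_value:
  assumes J: "ideal J R" and g: "g \<in> carrier R" and mg: "\<And>x. x \<in> m \<Longrightarrow> x \<otimes> g \<in> J"
    and a: "a \<in> ideal_values R v (PIdl g <+> J) - ideal_values R v J"
    and b: "b \<in> ideal_values R v (PIdl g <+> J) - ideal_values R v J"
  shows "\<not> a < b"
proof
  assume less: "a < b"
  interpret J: ideal J R by fact
  have dec: "\<exists>u j. u \<in> carrier R - m \<and> j \<in> J \<and> f = u \<otimes> g \<oplus> j"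
    if f: "f \<in> PIdl g <+> J" "f \<noteq> \<zero>" "v f \<notin> ideal_values R v J" for f :: 'a
  proof -
    obtain u j where uj: "u \<in> carrier R" "j \<in> J" "f = u \<otimes> g \<oplus> j"
      using f(1) unfolding set_add_def' cgenideal_def by blast
    have "u \<notin> m"
    proof
      assume "u \<in> m"
      then have "f \<in> J" using uj mg by simp
      then show False using f(2,3) by (auto simp: ideal_values_def)
    qed
    then show ?thesis using uj by blast
  qed
  obtain f f' :: 'a where f: "f \<in> PIdl g <+> J" "f \<noteq> \<zero>" "v f = a"
    and f': "f' \<in> PIdl g <+> J" "f' \<noteq> \<zero>" "v f' = b"
    using a b by (auto simp: ideal_values_def)
  obtain u j where u: "u \<in> carrier R - m" "j \<in> J" "f = u \<otimes> g \<oplus> j"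
    using dec[of f] f a by auto
  obtain u' j' where u': "u' \<in> carrier R - m" "j' \<in> J" "f' = u' \<otimes> g \<oplus> j'"
    using dec[of f'] f' b by auto
  obtain c where c: "c \<in> carrier R - m" "\<one> \<ominus> c \<otimes> u \<in> m"
    using inverse_mod_maximal[OF u(1)] .
  have car: "u \<in> carrier R" "u' \<in> carrier R" "c \<in> carrier R" "j \<in> carrier R" "j' \<in> carrier R"
    "f \<in> carrier R" "f' \<in> carrier R"
    using u u' c J.Icarr g by auto
  \<comment> \<open>The summand of smaller value, placed first to match \<open>v_add_eq_left\<close>.\<close>
  define w where "w = \<ominus> (u' \<otimes> c \<otimes> f)"
  have "u' \<otimes> c \<noteq> \<zero>" "v (u' \<otimes> c) = 0"
    using v_eq_0[OF u'(1)] v_eq_0[OF c(1)] car v_mult[of u' c] integral_iff by auto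
  then have "u' \<otimes> c \<otimes> f \<noteq> \<zero>" "v (u' \<otimes> c \<otimes> f) = a"
    using f car v_mult[of "u' \<otimes> c" f] integral_iff by auto
  then have w: "w \<in> carrier R - {\<zero>}" "v w = a"
    unfolding w_def using car v_minus by auto
  have nz: "w \<oplus> f' \<noteq> \<zero>" "v (w \<oplus> f') = a"
    using v_add_eq_left[OF w(1), of f'] w(2) f' car less by auto
  have "w \<oplus> f' = u' \<otimes> ((\<one> \<ominus> c \<otimes> u) \<otimes> g) \<oplus> (j' \<oplus> \<ominus> (u' \<otimes> c \<otimes> j))"
    unfolding w_def u(3) u'(3) using car g by algebra
  also have "\<dots> \<in> J"
    using mg[OF c(2)] u(2) u'(2) car J.I_l_closed by auto
  finally have "a \<in> ideal_values R v J"
    using nz by (force simp: ideal_values_def)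
  then show False using a by blast
qed

text \<open>
  Adding the generators one at a time, each of them contributes at most one value.
\<close>

lemma card_new_values_le_length:
  assumes J: "ideal J R" and gs: "set gs \<subseteq> carrier R"
    and mg: "\<And>x g. x \<in> m \<Longrightarrow> g \<in> set gs \<Longrightarrow> x \<otimes> g \<in> J"
  shows "finite (ideal_values R v (Idl (set gs \<union> J)) - ideal_values R v J) \<and>
    card (ideal_values R v (Idl (set gs \<union> J)) - ideal_values R v J) \<le> length gs"
  using gs mg
proof (induction gs)
  case Nil
  have "Idl J \<subseteq> J" by (rule genideal_minimal[OF J]) simp
  then have "ideal_values R v (Idl (set [] \<union> J)) - ideal_values R v J = {}"
    by (auto simp: ideal_values_def)
  then show ?case by (simp only: card.empty finite.emptyI le0 simp_thms)
next
  case (Cons g gs)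
  let ?V = "ideal_values R v" and ?H = "Idl (set gs \<union> J)"
  let ?N = "?V (PIdl g <+> ?H) - ?V ?H"
  have Jc: "J \<subseteq> carrier R" using ideal.Icarr[OF J] by blast
  have c: "set gs \<union> J \<subseteq> carrier R" "g \<in> carrier R" using Jc Cons.prems by auto
  have H: "ideal ?H R" by (rule genideal_ideal[OF c(1)])
  have JH: "J \<subseteq> ?H" using genideal_self[OF c(1)] by simp
  have mgH: "x \<otimes> g \<in> ?H" if "x \<in> m" for x using Cons.prems(2)[OF that] JH by auto
  have not_less: "\<not> a < b" if "a \<in> ?N" "b \<in> ?N" for a b
    using H c(2) mgH that by (rule unique_new_value)
  have N: "finite ?N \<and> card ?N \<le> 1"
    by (rule antichain_card_le_1) (rule not_less)
  have diff: "T - W \<subseteq> (U - D) \<union> (D - W)" if "T \<subseteq> U" for T U W D :: "'g set"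
    using that by blast
  have "Idl (set (g # gs) \<union> J) \<subseteq> PIdl g <+> ?H"
    using genideal_insert_subset[OF c(2,1)] by simp
  then have "?V (Idl (set (g # gs) \<union> J)) \<subseteq> ?V (PIdl g <+> ?H)"
    unfolding ideal_values_def by (intro image_mono Diff_mono order.refl)
  then have sub: "?V (Idl (set (g # gs) \<union> J)) - ?V J \<subseteq> ?N \<union> (?V ?H - ?V J)"
    by (rule diff)
  have "finite (?V ?H - ?V J) \<and> card (?V ?H - ?V J) \<le> length gs"
  proof (rule Cons.IH)
    show "set gs \<subseteq> carrier R" using Cons.prems(1) by simp
    show "x \<otimes> h \<in> J" if "x \<in> m" "h \<in> set gs" for x h
      using Cons.prems(2)[OF that(1)] that(2) by simp
  qed
  then have IH: "finite (?V ?H - ?V J)" "card (?V ?H - ?V J) \<le> length gs" by blast+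
  have fin: "finite (?N \<union> (?V ?H - ?V J))" using N IH(1) by simp
  have "card (?V (Idl (set (g # gs) \<union> J)) - ?V J) \<le> card (?N \<union> (?V ?H - ?V J))"
    by (rule card_mono[OF fin sub])
  also have "\<dots> \<le> card ?N + card (?V ?H - ?V J)" by (rule card_Un_le)
  also have "\<dots> \<le> length (g # gs)" using N IH(2) by simp
  finally show ?case using finite_subset[OF sub fin] by blast
qed

lemma value_ideal_power_ge:
  assumes s: "\<And>x. x \<in> m - {\<zero>} \<Longrightarrow> s \<le> v x" and "f \<in> ideal_power m k" "f \<noteq> \<zero>"
  shows "(\<Sum>i<k. s) \<le> v f"
proof -
  have "ideal_power m k \<subseteq> {x \<in> carrier R. x = \<zero> \<or> (\<Sum>i<k. s) \<le> v x}"
  proof (induction k)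
    case 0
    then show ?case using v_nonneg by auto
  next
    case (Suc k)
    show ?case unfolding ideal_power.simps
    proof (rule ideal_prod_minimal[OF value_ge_ideal])
      fix x y assume x: "x \<in> m" and "y \<in> ideal_power m k"
      then have y: "y \<in> carrier R" "y = \<zero> \<or> (\<Sum>i<k. s) \<le> v y" using Suc.IH by auto
      have "(\<Sum>i<k. s) + s \<le> v x + v y" if "x \<noteq> \<zero>" "y \<noteq> \<zero>"
        using s[of x] x y(2) that by (simp add: add_mono add.commute)
      then show "x \<otimes> y \<in> {x \<in> carrier R. x = \<zero> \<or> (\<Sum>i<Suc k. s) \<le> v x}"
        using x y Icarr v_mult[of x y] by (cases "x = \<zero> \<or> y = \<zero>") auto
    qed
  qed
  then show ?thesis using assms(2,3) by blast
qed

text \<open>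
  The main count, in terms of any list of elements spanning \<open>m / m\<^sup>2\<close> and any lower bound \<open>s\<close> for
  the values of \<open>m\<close>.
\<close>

theorem card_small_values_less:
  assumes xs: "set xs \<subseteq> m" and gen: "m \<subseteq> Idl (set xs \<union> m \<cdot> m)"
    and s: "\<And>x. x \<in> m - {\<zero>} \<Longrightarrow> s \<le> v x"
  shows "finite {c \<in> ideal_values R v m. c < (\<Sum>i<d + 1. s)} \<and>
    card {c \<in> ideal_values R v m. c < (\<Sum>i<d + 1. s)} < (length xs + d) choose length xs"
proof -
  let ?V = "ideal_values R v" and ?P = "ideal_power m"
  let ?S = "{c \<in> ?V m. c < (\<Sum>i<d + 1. s)}" and ?N = "\<lambda>i. ?V (?P i) - ?V (?P (Suc i))"
  have xc: "set xs \<subseteq> carrier R" using xs Icarr by blast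
  have N: "finite (?N i) \<and> card (?N i) \<le> length (monomials xs i)" for i
  proof -
    let ?I = "Idl (set (monomials xs i) \<union> ?P (Suc i))"
    have *: "finite (?V ?I - ?V (?P (Suc i))) \<and>
        card (?V ?I - ?V (?P (Suc i))) \<le> length (monomials xs i)"
      using monomials_in_ideal_power[OF is_ideal xs, of i]
      by (intro card_new_values_le_length ideal_power_ideal is_ideal monomials_closed[OF xc])
        (auto intro: ideal_prod.prod)
    have "?N i \<subseteq> ?V ?I - ?V (?P (Suc i))"
      using ideal_power_generators[OF is_ideal xs gen, of i] by (auto simp: ideal_values_def)
    then show ?thesis using * by (meson card_mono finite_subset order_trans)
  qed
  \<comment> \<open>Each value of the ring either survives down to the last power or is lost at some step.\<close>
  have tele: "?V (?P 0) \<subseteq> (\<Union>i\<le>k. ?N i) \<union> ?V (?P (Suc k))" for k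
    by (induction k) (auto simp: atMost_Suc simp del: ideal_power.simps)
  have large: "(\<Sum>i<d + 1. s) \<le> c" if "c \<in> ?V (?P (Suc d))" for c
    using that value_ideal_power_ge[OF s, of _ "Suc d"] by (auto simp: ideal_values_def)
  have s0: "0 < (\<Sum>i<d + 1. s)" if nonempty: "?S \<noteq> {}"
  proof -
    obtain x where "x \<in> m - {\<zero>}" "v x < (\<Sum>i<d + 1. s)"
      using nonempty unfolding ideal_values_def by blast
    then show ?thesis using v_nonneg[of x] Icarr by fastforce
  qed
  have card_Un: "finite (\<Union>i\<le>d. ?N i)" "card (\<Union>i\<le>d. ?N i) \<le> (length xs + d) choose length xs"
  proof -
    show "finite (\<Union>i\<le>d. ?N i)" using N by blast
    have "card (\<Union>i\<le>d. ?N i) \<le> (\<Sum>i\<le>d. card (?N i))" by (rule card_UN_le) simp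
    also have "\<dots> \<le> (\<Sum>i\<le>d. length (monomials xs i))" using N by (intro sum_mono) blast
    finally show "card (\<Union>i\<le>d. ?N i) \<le> (length xs + d) choose length xs"
      by (simp only: sum_length_monomials)
  qed
  show ?thesis
  proof (cases "?S = {}")
    case True
    show ?thesis unfolding True by simp
  next
    case False
    \<comment> \<open>The value \<open>0\<close> of \<open>\<one>\<close> is lost as well, and it is a value outside \<open>?S\<close>.\<close>
    have "0 \<in> ?V (?P 0)" using v_one by (force simp: ideal_values_def)
    then have "insert 0 ?S \<subseteq> ?V (?P 0)" using Icarr by (auto simp: ideal_values_def)
    moreover have "c \<notin> ?V (?P (Suc d))" if "c \<in> insert 0 ?S" for c
      using that large[of c] s0[OF False] by auto
    ultimately have sub: "insert 0 ?S \<subseteq> (\<Union>i\<le>d. ?N i)"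
      using tele[of d] by blast
    have fin: "finite (insert 0 ?S)" by (rule finite_subset[OF sub card_Un(1)])
    have "0 \<notin> ?S"
    proof
      assume "0 \<in> ?S"
      then have "0 \<in> v ` (m - {\<zero>})" by (simp add: ideal_values_def)
      then obtain x where x: "0 = v x" "x \<in> m - {\<zero>}" by (rule imageE)
      then have "0 < v x" using v_pos_iff[of x] Icarr by blast
      then show False unfolding x(1)[symmetric] by (rule less_irrefl[THEN notE])
    qed
    then have "Suc (card ?S) = card (insert 0 ?S)"
      using fin unfolding finite_insert by (intro card_insert_disjoint[symmetric])
    also have "\<dots> \<le> (length xs + d) choose length xs"
      using card_mono[OF card_Un(1) sub] card_Un(2) by (rule order.trans)
    finally have "card ?S < (length xs + d) choose length xs" by (simp only: Suc_le_eq)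
    then show ?thesis using fin by (simp only: finite_insert simp_thms)
  qed
qed

text \<open>
  The least value in the definition of \<open>min_value\<close> exists because \<open>m\<close> is finitely generated: the
  elements of value at least \<open>s\<close> form an ideal, so the minimum over a finite set of generators is a
  lower bound on all of \<open>m\<close>.
\<close>

lemma min_value_le:
  assumes S: "finite S" "S \<subseteq> carrier R" "m = Idl S" and x: "x \<in> m - {\<zero>}"
  shows "min_value R v m \<le> v x"
proof -
  let ?T = "v ` (S - {\<zero>})"
  have Sm: "S \<subseteq> m" using genideal_self S by blast
  have T: "finite ?T" using S(1) by simp
  have "?T \<noteq> {}"
  proof
    assume "?T = {}"
    then have "Idl S \<subseteq> {\<zero>}" by (intro genideal_minimal zeroideal) auto
    then show False using S x by blast
  qed
  then have mem: "Min ?T \<in> ideal_values R v m"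
    using Min_in[OF T] Sm by (auto simp: ideal_values_def)
  have "Idl S \<subseteq> {x \<in> carrier R. x = \<zero> \<or> Min ?T \<le> v x}"
  proof (intro genideal_minimal value_ge_ideal subsetI)
    fix y assume y: "y \<in> S"
    then have "Min ?T \<le> v y" if "y \<noteq> \<zero>" using Min_le[OF T] that by blast
    then show "y \<in> {x \<in> carrier R. x = \<zero> \<or> Min ?T \<le> v x}" using y S(2) by blast
  qed
  then have low: "Min ?T \<le> v y" if "y \<in> m - {\<zero>}" for y using S(3) that by blast
  then have "min_value R v m = Min ?T"
    unfolding min_value_def using mem by (intro Least_equality) (auto simp: ideal_values_def)
  then show ?thesis using low x by simp
qed

end

section \<open>Lifting generators of the cotangent space\<close>

context local_ring
begin

lemma cotangent_carrier: "carrier (cotangent_space R m) = (\<lambda>x. (m \<cdot> m) +> x) ` m"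
  by (simp add: cotangent_space_def)

lemma cotangent_add:
  assumes "x \<in> carrier R" "y \<in> carrier R"
  shows "((m \<cdot> m) +> x) \<oplus>\<^bsub>cotangent_space R m\<^esub> ((m \<cdot> m) +> y) = (m \<cdot> m) +> (x \<oplus> y)"
proof -
  interpret I: ideal "m \<cdot> m" R by (rule ideal_m2)
  show ?thesis using I.a_rcos_sum assms by (simp add: cotangent_space_def)
qed

lemma cotangent_zero: "\<zero>\<^bsub>cotangent_space R m\<^esub> = (m \<cdot> m) +> \<zero>"
proof -
  interpret I: ideal "m \<cdot> m" R by (rule ideal_m2)
  show ?thesis using a_rcos_zero[OF ideal_m2 I.zero_closed] by (simp add: cotangent_space_def)
qed

lemma cotangent_scalar:
  assumes "a \<in> carrier R" "x \<in> m"
  shows "(m +> a) \<odot>\<^bsub>cotangent_space R m\<^esub> ((m \<cdot> m) +> x) = (m \<cdot> m) +> (a \<otimes> x)"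
  using cotangent_smult[OF assms] by (simp add: cotangent_space_def)

lemma residue_carrier: "carrier (R Quot m) = (\<lambda>x. m +> x) ` carrier R"
  by (auto simp: FactRing_def A_RCOSETS_def' a_r_coset_def)

text \<open>
  This lemma and the next carry spans in the cotangent space to ideals of the ring and back, so that
  no linear combination has to be written down.
\<close>

lemma ideal_image_submodule:
  assumes H: "ideal H R" "H \<subseteq> m"
  shows "submodule (R Quot m) ((\<lambda>x. (m \<cdot> m) +> x) ` H) (cotangent_space R m)"
proof -
  interpret V: vectorspace "R Quot m" "cotangent_space R m" by (rule cotangent_vectorspace)
  interpret H: ideal H R by fact
  show ?thesis
  proof
    show "(\<lambda>x. (m \<cdot> m) +> x) ` H \<subseteq> carrier (cotangent_space R m)"
      using H(2) by (auto simp: cotangent_carrier)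
    show "\<zero>\<^bsub>cotangent_space R m\<^esub> \<in> (\<lambda>x. (m \<cdot> m) +> x) ` H"
      by (auto simp: cotangent_zero)
  next
    fix u w assume "u \<in> (\<lambda>x. (m \<cdot> m) +> x) ` H" "w \<in> (\<lambda>x. (m \<cdot> m) +> x) ` H"
    then show "u \<oplus>\<^bsub>cotangent_space R m\<^esub> w \<in> (\<lambda>x. (m \<cdot> m) +> x) ` H"
      using cotangent_add H.Icarr by auto
  next
    fix c u assume "c \<in> carrier (R Quot m)" "u \<in> (\<lambda>x. (m \<cdot> m) +> x) ` H"
    then obtain a x where "a \<in> carrier R" "c = m +> a" "x \<in> H" "u = (m \<cdot> m) +> x"
      by (auto simp: residue_carrier)
    then show "c \<odot>\<^bsub>cotangent_space R m\<^esub> u \<in> (\<lambda>x. (m \<cdot> m) +> x) ` H"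
      using cotangent_scalar H.I_l_closed H(2) by auto
  qed
qed

lemma submodule_preimage_ideal:
  assumes N: "submodule (R Quot m) N (cotangent_space R m)"
  shows "ideal {x \<in> m. (m \<cdot> m) +> x \<in> N} R"
proof -
  interpret N: submodule "R Quot m" N "cotangent_space R m" by fact
  have sm: "a \<otimes> x \<in> {x \<in> m. (m \<cdot> m) +> x \<in> N}"
    if "x \<in> {x \<in> m. (m \<cdot> m) +> x \<in> N}" "a \<in> carrier R" for a x
    using that N.smult_closed[of "m +> a" "(m \<cdot> m) +> x"] cotangent_scalar[of a x] I_l_closed
    by (auto simp: residue_carrier)
  show ?thesis
  proof (rule idealI[OF ring_axioms])
    have "\<ominus> x \<in> {x \<in> m. (m \<cdot> m) +> x \<in> N}" if "x \<in> {x \<in> m. (m \<cdot> m) +> x \<in> N}" for x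
      using sm[OF that, of "\<ominus> \<one>"] that Icarr by (simp add: l_minus)
    moreover have "x \<oplus> y \<in> {x \<in> m. (m \<cdot> m) +> x \<in> N}"
      if "x \<in> {x \<in> m. (m \<cdot> m) +> x \<in> N}" "y \<in> {x \<in> m. (m \<cdot> m) +> x \<in> N}" for x y
      using that N.m_closed[of "(m \<cdot> m) +> x" "(m \<cdot> m) +> y"] cotangent_add[of x y] Icarr
      by simp
    moreover have "\<zero> \<in> {x \<in> m. (m \<cdot> m) +> x \<in> N}"
      using N.zero_closed cotangent_zero zero_closed by simp
    ultimately show "subgroup {x \<in> m. (m \<cdot> m) +> x \<in> N} (add_monoid R)"
      using Icarr by (auto simp: subgroup_def simp flip: a_inv_def)
  next
    fix a x assume ax: "a \<in> {x \<in> m. (m \<cdot> m) +> x \<in> N}" "x \<in> carrier R"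
    show "x \<otimes> a \<in> {x \<in> m. (m \<cdot> m) +> x \<in> N}" by (rule sm[OF ax])
    then show "a \<otimes> x \<in> {x \<in> m. (m \<cdot> m) +> x \<in> N}"
      using ax m_comm Icarr by auto
  qed
qed

text \<open>
  The dimension is the least size of a generating set.  Since \<open>m\<close> is finitely generated, the
  cotangent space has a finite generating set, so this least size is attained; choosing one element
  of \<open>m\<close> in each coset of a smallest generating set gives the list.
\<close>

lemma generators_mod_square:
  assumes S: "finite S" "S \<subseteq> carrier R" "m = Idl S"
  obtains xs where "set xs \<subseteq> m" "m \<subseteq> Idl (set xs \<union> m \<cdot> m)" "length xs = embedding_dim R m"
proof -
  interpret V: vectorspace "R Quot m" "cotangent_space R m" by (rule cotangent_vectorspace)
  interpret I: ideal "m \<cdot> m" R by (rule ideal_m2)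
  let ?V = "cotangent_space R m" and ?q = "\<lambda>x. (m \<cdot> m) +> x"
  have Sm: "S \<subseteq> m" using genideal_self S by blast
  then have qS: "?q ` S \<subseteq> carrier ?V" by (auto simp: cotangent_carrier)
  have span: "V.span (?q ` S) = carrier ?V"
  proof
    show "V.span (?q ` S) \<subseteq> carrier ?V" by (rule V.span_is_subset2[OF qS])
    have "Idl S \<subseteq> {x \<in> m. ?q x \<in> V.span (?q ` S)}"
      using V.in_own_span[OF qS] Sm
      by (intro genideal_minimal submodule_preimage_ideal V.span_is_submodule qS) auto
    then show "carrier ?V \<subseteq> V.span (?q ` S)"
      unfolding cotangent_carrier S(3)[symmetric] by blast
  qed
  then have "\<exists>B. finite B \<and> card B = card (?q ` S) \<and> B \<subseteq> carrier ?V \<and> V.gen_set B"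
    using qS S(1) by blast
  then have "\<exists>B. finite B \<and> card B = V.dim \<and> B \<subseteq> carrier ?V \<and> V.gen_set B"
    unfolding V.dim_def by (rule LeastI)
  then obtain B where B: "finite B" "card B = V.dim" "B \<subseteq> carrier ?V" "V.gen_set B" by blast
  obtain Y where Y: "Y \<subseteq> m" "inj_on ?q Y" "B = ?q ` Y"
    using B(3) unfolding cotangent_carrier by (meson subset_image_inj)
  have finX: "finite Y" using B(1) Y finite_imageD by blast
  then obtain xs where xs: "set xs = Y" "distinct xs" using finite_distinct_list by blast
  have len: "length xs = embedding_dim R m"
    using B(2) Y xs by (simp add: embedding_dim_def card_image flip: distinct_card)
  let ?H = "Idl (Y \<union> m \<cdot> m)"
  have sub: "Y \<union> m \<cdot> m \<subseteq> m" using Y(1) m2_subset by blast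
  then have car: "Y \<union> m \<cdot> m \<subseteq> carrier R" using Icarr by blast
  interpret H: ideal ?H R by (rule genideal_ideal[OF car])
  have Hm: "?H \<subseteq> m" by (rule genideal_minimal[OF is_ideal sub])
  have YH: "Y \<subseteq> ?H" "m \<cdot> m \<subseteq> ?H" using genideal_self[OF car] by auto
  have "V.span B \<subseteq> ?q ` ?H"
    by (rule V.span_is_subset[OF _ ideal_image_submodule[OF H.ideal_axioms Hm]])
      (use Y YH in auto)
  then have cosets: "?q ` m \<subseteq> ?q ` ?H" using B(4) by (simp add: cotangent_carrier)
  have "m \<subseteq> ?H"
  proof
    fix x assume x: "x \<in> m"
    then obtain h where h: "h \<in> ?H" "?q x = ?q h" using cosets by blast
    have c: "x \<in> carrier R" "h \<in> carrier R" using x h Icarr H.Icarr by blast+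
    have "x \<ominus> h \<in> m \<cdot> m" using quotient_eq_iff_same_a_r_cos[OF ideal_m2 c] h(2) by simp
    then have "(x \<ominus> h) \<oplus> h \<in> ?H" using YH h(1) by blast
    moreover have "(x \<ominus> h) \<oplus> h = x" using c by algebra
    ultimately show "x \<in> ?H" by simp
  qed
  then show thesis using that[of xs] xs Y(1) len by simp
qed

end

section \<open>The bound on the number of values\<close>

theorem theorem2p1:
  fixes K :: "('a, 'b) ring_scheme" and A m :: "'a set"
    and \<nu> :: "'a \<Rightarrow> 'g::linordered_ab_group_add"
  defines "R \<equiv> K\<lparr>carrier := A\<rparr>"
  assumes "quotient_field K A"
    and "noetherian_ring R"
    and "local_ring R m"
    and "\<not> field R"
    and "equicharacteristic R m"
    and "valuation K \<nu>"
    and "dominates K \<nu> A m"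
  shows "\<forall>d::nat.
    finite (rank1_values K \<nu> m
      \<inter> rank1_interval (value_group K \<nu>) (\<Sum>i<d + 1. min_value K \<nu> m)) \<and>
    card (rank1_values K \<nu> m
      \<inter> rank1_interval (value_group K \<nu>) (\<Sum>i<d + 1. min_value K \<nu> m))
    < (embedding_dim R m + d) choose (embedding_dim R m)"
proof
  fix d :: nat
  interpret K: quotient_field K A by fact
  interpret N: valuation K \<nu> by fact
  interpret L: local_ring R m by fact
  have ops: "carrier R = A" "\<zero>\<^bsub>R\<^esub> = \<zero>\<^bsub>K\<^esub>" "monoid.mult R = monoid.mult K" "ring.add R = ring.add K"
    by (simp_all add: R_def)
  have AK: "A \<subseteq> carrier K" by (rule K.subset)
  have "domain R" unfolding R_def by (rule K.subring_is_domain[OF K.subring_axioms])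
  then interpret centred_valuation R m \<nu>
  proof (intro centred_valuation.intro centred_valuation_axioms.intro L.maximalideal_axioms)
    have dom: "A \<subseteq> valuation_ring K \<nu>" "valuation_ideal K \<nu> \<inter> A = m"
      using \<open>dominates K \<nu> A m\<close> by (auto simp: dominates_def)
    fix x assume x: "x \<in> carrier R - {\<zero>\<^bsub>R\<^esub>}"
    then have x': "x \<in> A" "x \<in> carrier K" "x \<noteq> \<zero>\<^bsub>K\<^esub>" using AK by (auto simp: ops)
    show "0 \<le> \<nu> x" using dom(1) x' by (auto simp: valuation_ring_def)
    show "0 < \<nu> x \<longleftrightarrow> x \<in> m" using dom(2) x' by (auto simp: valuation_ideal_def)
    fix y assume "y \<in> carrier R - {\<zero>\<^bsub>R\<^esub>}"
    then have y': "y \<in> carrier K" "y \<noteq> \<zero>\<^bsub>K\<^esub>" using AK by (auto simp: ops)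
    show "\<nu> (x \<otimes>\<^bsub>R\<^esub> y) = \<nu> x + \<nu> y" using N.val_mult x' y' by (simp add: ops)
    show "min (\<nu> x) (\<nu> y) \<le> \<nu> (x \<oplus>\<^bsub>R\<^esub> y)" if "x \<oplus>\<^bsub>R\<^esub> y \<noteq> \<zero>\<^bsub>R\<^esub>"
      using N.val_add x' y' that by (simp add: ops)
  qed
  obtain S where S: "S \<subseteq> carrier R" "finite S" "m = Idl\<^bsub>R\<^esub> S"
    using noetherian_ring.finetely_gen[OF \<open>noetherian_ring R\<close> L.is_ideal] by blast
  obtain xs where xs: "set xs \<subseteq> m" "m \<subseteq> Idl\<^bsub>R\<^esub> (set xs \<union> m \<cdot>\<^bsub>R\<^esub> m)"
      "length xs = embedding_dim R m"
    using L.generators_mod_square[OF S(2,1,3)] by blast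
  have val: "ideal_values R \<nu> m = ideal_values K \<nu> m" "min_value R \<nu> m = min_value K \<nu> m"
    by (simp_all add: ideal_values_def min_value_def ops)
  let ?b = "\<Sum>i<d + 1. min_value K \<nu> m"
  let ?W = "{c \<in> ideal_values K \<nu> m. c < ?b}"
  let ?T = "rank1_values K \<nu> m \<inter> rank1_interval (value_group K \<nu>) ?b"
  have bound: "finite ?W \<and> card ?W < (embedding_dim R m + d) choose (embedding_dim R m)"
    using card_small_values_less[OF xs(1,2) min_value_le[OF S(2,1,3)], where d = d]
    unfolding val xs(3) by blast
  have sub: "?T \<subseteq> ?W" by (auto simp: rank1_values_def rank1_interval_def)
  have "card ?T \<le> card ?W" using bound card_mono[OF _ sub] by blast
  then show "finite ?T \<and> card ?T < (embedding_dim R m + d) choose (embedding_dim R m)"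
    using bound finite_subset[OF sub] by (meson le_less_trans)
qed

end
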